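(* Let $a<b$ be real numbers, $T=b-a$, and $t\in(a,b)$ fixed. Let $$K(x)=\frac{\cos\frac{\pi(x-t)}{T}}{\sin^3\frac{\pi(x-t)}{T}},\qquad e_m(x)=e^{\mathrm{i}2m\pi x/T},\qquad f_m(x)=K(x)e_m(x),\qquad m=0,\pm1,\pm2,\ldots.$$ Then the supersingular integral $I[f_m]$, i.e. the Hadamard Finite Part of $\int_a^b f_m(x)\,dx$, satisfies $$I[f_m]=-\mathrm{i}\,\operatorname{sgn}(m)\,2T\,m^2\,e_m(t),\qquad m=0,\pm1,\pm2,\ldots.$$
   Context: For $t\in(a,b)$ and $f(x)=g(x)/(x-t)^3$ with $g\in C^\infty[a,b]$, $I[f]$ denotes the Hadamard Finite Part of the (divergent) integral $\int_a^b f(x)\,dx$, that is, $$I[f]=\lim_{\epsilon\to0+}\left[\int_a^{t-\epsilon}\frac{g(x)}{(x-t)^3}\,dx+\int_{t+\epsilon}^b\frac{g(x)}{(x-t)^3}\,dx-\frac{2g'(t)}{\epsilon}\right].$$ Each $f_m$ is of this form with $g(x)=(x-t)^3f_m(x)$ (extended smoothly to $x=t$). Also $\operatorname{sgn}(m)=1,0,-1$ for $m>0$, $m=0$, $m<0$ respectively. *)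

theory Defs
  imports "HOL-Complex_Analysis.Complex_Analysis"
begin

text \<open>\<open>C\<^sup>\<infinity>[a,b]\<close>: \<open>G n\<close> is the \<open>n\<close>-th derivative of \<open>g\<close>, one-sided at the endpoints.\<close>

definition C_infinity_on :: "(real \<Rightarrow> complex) \<Rightarrow> real \<Rightarrow> real \<Rightarrow> bool" where
  "C_infinity_on g a b \<longleftrightarrow>
     (\<exists>G :: nat \<Rightarrow> real \<Rightarrow> complex.
        (\<forall>x\<in>{a..b}. G 0 x = g x) \<and>
        (\<forall>n. \<forall>x\<in>{a..b}. (G n has_vector_derivative G (Suc n) x) (at x within {a..b})))"

text \<open>The value \<open>f t\<close> is irrelevant: the numerator \<open>g\<close> is determined on \<open>{a..b}\<close> by \<open>f\<close> off \<open>t\<close>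
  and by continuity at \<open>t\<close>. Since \<open>g\<close> is continuous on \<open>{a..b}\<close>, both integrals exist for
  every small \<open>\<epsilon> > 0\<close>.\<close>

definition has_finite_part3 :: "(real \<Rightarrow> complex) \<Rightarrow> real \<Rightarrow> real \<Rightarrow> real \<Rightarrow> complex \<Rightarrow> bool" where
  "has_finite_part3 f a b t L \<longleftrightarrow>
     a < t \<and> t < b \<and>
     (\<exists>g. C_infinity_on g a b \<and>
        (\<forall>x\<in>{a..b} - {t}. f x = g x / of_real ((x - t) ^ 3)) \<and>
        ((\<lambda>\<epsilon>. integral {a..t - \<epsilon>} (\<lambda>x. g x / of_real ((x - t) ^ 3))
             + integral {t + \<epsilon>..b} (\<lambda>x. g x / of_real ((x - t) ^ 3))
             - 2 * vector_derivative g (at t) / of_real \<epsilon>) \<longlongrightarrow> L) (at_right 0))"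

definition finite_part3 :: "(real \<Rightarrow> complex) \<Rightarrow> real \<Rightarrow> real \<Rightarrow> real \<Rightarrow> complex" where
  "finite_part3 f a b t = (THE L. has_finite_part3 f a b t L)"

definition K_ss :: "real \<Rightarrow> real \<Rightarrow> real \<Rightarrow> real" where
  "K_ss T t x = cos (pi * (x - t) / T) / sin (pi * (x - t) / T) ^ 3"

definition e_mode :: "real \<Rightarrow> int \<Rightarrow> real \<Rightarrow> complex" where
  "e_mode T m x = exp (\<i> * of_real (2 * of_int m * pi * x / T))"

definition f_ss :: "real \<Rightarrow> real \<Rightarrow> int \<Rightarrow> real \<Rightarrow> complex" where
  "f_ss T t m x = of_real (K_ss T t x) * e_mode T m x"

end

theory Submission imports Defs "HOL-Real_Asymp.Real_Asymp" begin

text \<open>With \<open>u = \<pi>(x - t)/T\<close> and \<open>w = exp (2\<i>u)\<close> the integrand is, up to the factor \<open>e_mode T m t\<close>,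
  \<open>w\<^sup>m cos u / sin\<^sup>3 u\<close> over one period. Integrating by parts twice reduces it to
  \<open>-2m\<^sup>2 w\<^sup>m cot u\<close> plus boundary terms. These are \<open>\<pi>\<close>-periodic, and their jump across \<open>u = 0\<close>
  cancels the subtracted \<open>2g'(t)/\<epsilon>\<close> up to \<open>o(1)\<close>. The principal value of \<open>w\<^sup>m cot u\<close> over a period
  is \<open>\<i>\<pi> sgn m\<close>, by induction on \<open>m\<close> in both directions from
  \<open>(w - 1) cot u = \<i>(w + 1)\<close>.\<close>

section \<open>Uniqueness of the finite part\<close>

lemma C_infinity_on_has_vector_derivative:
  assumes "C_infinity_on g a b" "x \<in> {a<..<b}"
  shows "\<exists>D. (g has_vector_derivative D) (at x)"
proof -
  obtain G :: "nat \<Rightarrow> real \<Rightarrow> complex" where G0: "\<And>x. x \<in> {a..b} \<Longrightarrow> G 0 x = g x"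
    and G: "\<And>n x. x \<in> {a..b} \<Longrightarrow> (G n has_vector_derivative G (Suc n) x) (at x within {a..b})"
    using assms(1) unfolding C_infinity_on_def by blast
  have x: "x \<in> {a..b}" using assms(2) by auto
  have "(g has_vector_derivative G 1 x) (at x within {a..b})"
    using has_vector_derivative_transform[OF x _ G[OF x, of 0], of g] G0 by simp
  then show ?thesis
    using assms(2) by (auto simp: at_within_Icc_at)
qed

text \<open>Two admissible numerators agree off \<open>t\<close> because both equal \<open>f\<close>
  times the cube, then at \<open>t\<close> by continuity, and so have the same derivative there. The
  regularised expressions thus coincide for every positive \<open>\<epsilon>\<close>. This is what
  gives the description operator in \<open>finite_part3\<close> its meaning.\<close>

lemma has_finite_part3_unique:
  assumes "has_finite_part3 f a b t L" "has_finite_part3 f a b t M"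
  shows "L = M"
proof -
  from assms(1) obtain g where t: "a < t" "t < b" and g: "C_infinity_on g a b"
    and fg: "\<And>x. x \<in> {a..b} - {t} \<Longrightarrow> f x = g x / of_real ((x - t) ^ 3)"
    and L: "((\<lambda>\<epsilon>. integral {a..t - \<epsilon>} (\<lambda>x. g x / of_real ((x - t) ^ 3))
             + integral {t + \<epsilon>..b} (\<lambda>x. g x / of_real ((x - t) ^ 3))
             - 2 * vector_derivative g (at t) / of_real \<epsilon>) \<longlongrightarrow> L) (at_right 0)"
    unfolding has_finite_part3_def by blast
  from assms(2) obtain h where h: "C_infinity_on h a b"
    and fh: "\<And>x. x \<in> {a..b} - {t} \<Longrightarrow> f x = h x / of_real ((x - t) ^ 3)"
    and M: "((\<lambda>\<epsilon>. integral {a..t - \<epsilon>} (\<lambda>x. h x / of_real ((x - t) ^ 3))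
             + integral {t + \<epsilon>..b} (\<lambda>x. h x / of_real ((x - t) ^ 3))
             - 2 * vector_derivative h (at t) / of_real \<epsilon>) \<longlongrightarrow> M) (at_right 0)"
    unfolding has_finite_part3_def by blast
  have off: "g x = h x" if "x \<in> {a..b} - {t}" for x
    using fg[OF that] fh[OF that] that by simp
  have "t \<in> {a<..<b}" using t by simp
  then obtain D D' where D: "(g has_vector_derivative D) (at t)" and D': "(h has_vector_derivative D') (at t)"
    using C_infinity_on_has_vector_derivative g h by meson
  have lg: "(g \<longlongrightarrow> g t) (at t)" and lh: "(h \<longlongrightarrow> h t) (at t)"
    using D D' has_vector_derivative_continuous continuous_within by blast+
  have "eventually (\<lambda>x. x \<in> {a<..<b} - {t}) (at t)"
    using t by (intro eventually_at_in_open) auto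
  then have "eventually (\<lambda>x. g x = h x) (at t)"
    by eventually_elim (use off in auto)
  then have "(h \<longlongrightarrow> g t) (at t)"
    using lg tendsto_cong by blast
  then have "g t = h t"
    using lh tendsto_unique by (metis trivial_limit_at)
  with off have eq: "g x = h x" if "x \<in> {a..b}" for x
    using that by blast
  have "(h has_vector_derivative D) (at t)"
    by (rule has_vector_derivative_transform_within_open[OF D, of "{a<..<b}"]) (use t in \<open>auto intro: eq\<close>)
  then have vd: "vector_derivative g (at t) = vector_derivative h (at t)"
    using D vector_derivative_at by metis
  have "integral {a..t - \<epsilon>} (\<lambda>x. g x / of_real ((x - t) ^ 3)) = integral {a..t - \<epsilon>} (\<lambda>x. h x / of_real ((x - t) ^ 3))"
    "integral {t + \<epsilon>..b} (\<lambda>x. g x / of_real ((x - t) ^ 3)) = integral {t + \<epsilon>..b} (\<lambda>x. h x / of_real ((x - t) ^ 3))"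
    if "\<epsilon> > 0" for \<epsilon>
    using that t by (auto intro!: integral_cong simp: eq)
  then have "eventually (\<lambda>\<epsilon>. integral {a..t - \<epsilon>} (\<lambda>x. g x / of_real ((x - t) ^ 3))
             + integral {t + \<epsilon>..b} (\<lambda>x. g x / of_real ((x - t) ^ 3))
             - 2 * vector_derivative g (at t) / of_real \<epsilon> = integral {a..t - \<epsilon>} (\<lambda>x. h x / of_real ((x - t) ^ 3))
             + integral {t + \<epsilon>..b} (\<lambda>x. h x / of_real ((x - t) ^ 3))
             - 2 * vector_derivative h (at t) / of_real \<epsilon>) (at_right 0)"
    by (auto simp: eventually_at_filter vd)
  then show ?thesis
    using tendsto_unique[OF trivial_limit_at_right_real Lim_transform_eventually[OF L] M] by simp
qed

section \<open>Smooth numerators from holomorphic functions\<close>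

text \<open>The iterated complex derivatives, restricted to the real axis, serve as the family of
  derivatives of all orders.\<close>

lemma C_infinity_on_holomorphic:
  assumes "open S" "F holomorphic_on S" "\<And>x. x \<in> {a..b} \<Longrightarrow> of_real x \<in> S"
  shows "C_infinity_on (\<lambda>x. F (of_real x)) a b"
  unfolding C_infinity_on_def
proof (intro exI[of _ "\<lambda>n x. (deriv ^^ n) F (of_real x)"] conjI ballI allI)
  fix n x assume x: "x \<in> {a..b}"
  have "(deriv ^^ n) F holomorphic_on S"
    using assms by (simp add: holomorphic_higher_deriv)
  then have "((deriv ^^ n) F has_field_derivative (deriv ^^ Suc n) F (of_real x)) (at (of_real x))"
    using assms x holomorphic_derivI by fastforce
  then show "((\<lambda>x. (deriv ^^ n) F (of_real x)) has_vector_derivative (deriv ^^ Suc n) F (of_real x)) (at x within {a..b})"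
    by (rule has_vector_derivative_real_field)
qed simp

text \<open>The entire sinc function. It cancels the powers of \<open>x - t\<close> against the zero
  of the sine, so that the numerator has a closed form valid at \<open>t\<close> as well.\<close>

definition csinc :: "complex \<Rightarrow> complex" where
  "csinc z = (if z = 0 then 1 else sin z / z)"

text \<open>The singularity at 0 is removable: \<open>sin z / z\<close> is the difference quotient
  of the sine at 0, hence tends to 1.\<close>

lemma holomorphic_csinc: "csinc holomorphic_on UNIV"
proof (rule no_isolated_singularity[where K = "{0}"])
  have hol: "(\<lambda>z. sin z / z) holomorphic_on (UNIV - {0 :: complex})"
    by (intro holomorphic_intros) auto
  then show *: "csinc holomorphic_on (UNIV - {0})"
    by (rule holomorphic_transform) (auto simp: csinc_def)
  have "(sin has_field_derivative 1) (at (0::complex))"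
    using DERIV_sin[of "0::complex"] by simp
  then have "((\<lambda>z::complex. sin z / z) \<longlongrightarrow> 1) (at 0)"
    by (simp add: has_field_derivative_iff)
  then have "(csinc \<longlongrightarrow> 1) (at 0)"
    by (rule Lim_transform_eventually) (auto simp: csinc_def eventually_at_filter)
  then have 0: "isCont csinc 0" by (simp add: isCont_def csinc_def)
  have "isCont csinc z" if "z \<noteq> 0" for z
    using holomorphic_on_imp_continuous_on[OF *] that
    by (simp add: continuous_on_eq_continuous_at open_delete)
  with 0 show "continuous_on UNIV csinc"
    by (metis continuous_at_imp_continuous_on)
qed auto

text \<open>An even function has a derivative at 0 that equals its own negative.\<close>

lemma DERIV_csinc_0: "(csinc has_field_derivative 0) (at 0)"
proof -
  have d: "(csinc has_field_derivative deriv csinc 0) (at 0)"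
    using holomorphic_csinc holomorphic_derivI by blast
  have even: "csinc (- z) = csinc z" for z by (simp add: csinc_def)
  have "((\<lambda>z. csinc (- z)) has_field_derivative - deriv csinc 0) (at 0)"
    using DERIV_chain2[of csinc "deriv csinc 0" uminus 0 "-1" UNIV] d DERIV_minus[OF DERIV_ident, of 0 UNIV]
    by simp
  then have "(csinc has_field_derivative - deriv csinc 0) (at 0)"
    by (simp add: even)
  from DERIV_unique[OF this d] have "- deriv csinc 0 = deriv csinc 0" .
  then have "deriv csinc 0 = 0"
    by (simp add: complex_eq_iff)
  then show ?thesis using d by simp
qed

lemma csinc_of_real_nonzero:
  assumes "\<bar>u\<bar> < pi" shows "csinc (of_real u) \<noteq> 0"
  using assms sin_zero_pi_iff[of u] by (auto simp: csinc_def sin_of_real)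

section \<open>Antiderivatives of exponential and cotangent modes\<close>

text \<open>A nonconstant mode has a periodic antiderivative; the constant mode integrates to
  \<open>u\<close>. The increment \<open>pi\<close> in that one case is the source of the sign
  function below.\<close>

lemma exp_mode_antiderivative: "\<exists>E :: real \<Rightarrow> complex. (\<forall>u. (E has_vector_derivative exp (\<i> * of_real (2 * of_int k * u))) (at u))
   \<and> (\<forall>u. E (u + pi) - E u = (if k = 0 then of_real pi else 0))"
proof (cases "k = 0")
  case True
  then show ?thesis
    by (intro exI[of _ of_real]) (auto intro!: derivative_eq_intros has_vector_derivative_of_real[where D=1, simplified])
next
  case False
  define F where "F z = exp (\<i> * (2 * of_int k * z)) / (2 * \<i> * of_int k)" for z :: complex
  have "(F has_field_derivative exp (\<i> * (2 * of_int k * z))) (at z)" for z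
    unfolding F_def using False by (auto intro!: derivative_eq_intros simp: field_simps)
  then have "((\<lambda>u. F (of_real u)) has_vector_derivative exp (\<i> * of_real (2 * of_int k * u))) (at u)" for u
    using has_vector_derivative_real_field by fastforce
  moreover have "F (of_real (u + pi)) = F (of_real u)" for u
  proof -
    have "\<i> * (2 * of_int k * of_real (u + pi)) = \<i> * (2 * of_int k * of_real u) + \<i> * (of_int k * (of_real pi * 2))"
      by (simp add: algebra_simps)
    then show ?thesis by (simp only: F_def exp_plus_2pin)
  qed
  ultimately show ?thesis using False by (intro exI[of _ "\<lambda>u. F (of_real u)"]) auto
qed

text \<open>This is \<open>(w - 1) cot u = \<i> (w + 1)\<close> times the \<open>m\<close>-th power
  of \<open>w\<close>. The difference of consecutive modes cancels the pole, leaving pure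
  exponentials.\<close>

lemma cot_mult_exp_mode_diff:
  fixes u :: real
  assumes "sin u \<noteq> 0"
  shows "of_real (cot u) * (exp (\<i> * of_real (2 * of_int (m+1) * u)) - exp (\<i> * of_real (2 * of_int m * u)))
    = \<i> * (exp (\<i> * of_real (2 * of_int (m+1) * u)) + exp (\<i> * of_real (2 * of_int m * u)))"
proof -
  have e: "exp (\<i> * of_real (2 * of_int (m+1) * u)) = exp (\<i> * of_real (2 * of_int m * u)) * cis (2 * u)"
    by (simp add: cis_conv_exp exp_add[symmetric] algebra_simps)
  \<comment> \<open>Real and imaginary parts are the subtraction formulas for
    \<open>2 * u - u\<close>.\<close>
  have "of_real (cos u) * (cis (2 * u) - 1) = \<i> * of_real (sin u) * (cis (2 * u) + 1)"
    using cos_diff[of "2 * u" u] sin_diff[of "2 * u" u] by (simp add: complex_eq_iff algebra_simps)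
  then have "of_real (cot u) * (cis (2 * u) - 1) = \<i> * (cis (2 * u) + 1)"
    using assms by (simp add: cot_def field_simps)
  then have "exp (\<i> * of_real (2 * of_int m * u)) * (of_real (cot u) * (cis (2 * u) - 1)) = exp (\<i> * of_real (2 * of_int m * u)) * (\<i> * (cis (2 * u) + 1))" by simp
  then show ?thesis unfolding e by (simp add: algebra_simps)
qed

text \<open>Subtracting 1 from the mode removes the pole of the cotangent, so \<open>P\<close> can
  be continuous even at the zeros of the sine. Since the cotangent itself has principal value 0 over
  a period, the increment of \<open>P\<close> is the principal value of the whole mode.\<close>

lemma cot_mode_antiderivative: "\<exists>P :: real \<Rightarrow> complex. 
    (\<forall>u. isCont P u) \<and>
    (\<forall>u. sin u \<noteq> 0 \<longrightarrow> (P has_vector_derivative of_real (cot u) * (exp (\<i> * of_real (2 * of_int m * u)) - 1)) (at u))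
   \<and> (\<forall>u. P (u + pi) - P u = \<i> * of_real pi * of_int (sgn m))"
  (is "\<exists>P. ?Q m P")
proof (induction m rule: int_induct[where k = 0])
  case base
  show ?case by (intro exI[of _ "\<lambda>_. 0"]) simp
next
  case (step1 m)
  then obtain P where P: "?Q m P" by blast
  obtain E :: "real \<Rightarrow> complex" where E: "\<And>u. (E has_vector_derivative exp (\<i> * of_real (2 * of_int m * u))) (at u)" "\<And>u. E (u + pi) - E u = (if m = 0 then of_real pi else 0)"
    using exp_mode_antiderivative by blast
  obtain E' :: "real \<Rightarrow> complex" where E': "\<And>u. (E' has_vector_derivative exp (\<i> * of_real (2 * of_int (m+1) * u))) (at u)" "\<And>u. E' (u + pi) - E' u = (if m+1 = 0 then of_real pi else 0)"
    using exp_mode_antiderivative by blast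
  show ?case
  proof (intro exI[of _ "\<lambda>u. P u + \<i> * (E' u + E u)"] conjI allI impI)
    fix u :: real
    show "isCont (\<lambda>u. P u + \<i> * (E' u + E u)) u"
      using P E(1) E'(1) has_vector_derivative_continuous by (intro continuous_intros) blast+
    show "P (u + pi) + \<i> * (E' (u + pi) + E (u + pi)) - (P u + \<i> * (E' u + E u)) = \<i> * of_real pi * of_int (sgn (m + 1))"
    proof -
      have "P (u + pi) + \<i> * (E' (u + pi) + E (u + pi)) - (P u + \<i> * (E' u + E u)) = (P (u+pi) - P u) + \<i> * ((E' (u + pi) - E' u) + (E (u + pi) - E u))" by (simp add: algebra_simps)
      \<comment> \<open>As \<open>m\<close> is nonnegative, the only nonzero increment is that of
        \<open>E\<close> for \<open>m = 0\<close>, where the sign rises from 0 to 1.\<close>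
      also have "\<dots> = \<i> * of_real pi * of_int (sgn (m + 1))"
        unfolding E E' using P step1(1) by (auto simp: sgn_if algebra_simps)
      finally show ?thesis .
    qed
    assume u: "sin u \<noteq> 0"
    have "((\<lambda>u. P u + \<i> * (E' u + E u)) has_vector_derivative of_real (cot u) * (exp (\<i> * of_real (2 * of_int m * u)) - 1) + \<i> * (exp (\<i> * of_real (2 * of_int (m+1) * u)) + exp (\<i> * of_real (2 * of_int m * u)))) (at u)"
      using P u by (intro has_vector_derivative_add has_vector_derivative_mult_right E E') blast+
    then show "((\<lambda>u. P u + \<i> * (E' u + E u)) has_vector_derivative of_real (cot u) * (exp (\<i> * of_real (2 * of_int (m+1) * u)) - 1)) (at u)"
      unfolding cot_mult_exp_mode_diff[OF u, symmetric] by (simp add: algebra_simps)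
  qed
next
  case (step2 m)
  then obtain P where P: "?Q m P" by blast
  obtain E :: "real \<Rightarrow> complex" where E: "\<And>u. (E has_vector_derivative exp (\<i> * of_real (2 * of_int m * u))) (at u)" "\<And>u. E (u + pi) - E u = (if m = 0 then of_real pi else 0)"
    using exp_mode_antiderivative by blast
  obtain E' :: "real \<Rightarrow> complex" where E': "\<And>u. (E' has_vector_derivative exp (\<i> * of_real (2 * of_int (m-1) * u))) (at u)" "\<And>u. E' (u + pi) - E' u = (if m-1 = 0 then of_real pi else 0)"
    using exp_mode_antiderivative by blast
  show ?case
  proof (intro exI[of _ "\<lambda>u. P u - \<i> * (E' u + E u)"] conjI allI impI)
    fix u :: real
    show "isCont (\<lambda>u. P u - \<i> * (E' u + E u)) u"
      using P E(1) E'(1) has_vector_derivative_continuous by (intro continuous_intros) blast+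
    show "P (u + pi) - \<i> * (E' (u + pi) + E (u + pi)) - (P u - \<i> * (E' u + E u)) = \<i> * of_real pi * of_int (sgn (m - 1))"
    proof -
      have "P (u + pi) - \<i> * (E' (u + pi) + E (u + pi)) - (P u - \<i> * (E' u + E u)) = (P (u+pi) - P u) - \<i> * ((E' (u + pi) - E' u) + (E (u + pi) - E u))" by (simp add: algebra_simps)
      also have "\<dots> = \<i> * of_real pi * of_int (sgn (m - 1))"
        unfolding E E' using P step2(1) by (auto simp: sgn_if algebra_simps)
      finally show ?thesis .
    qed
    assume u: "sin u \<noteq> 0"
    \<comment> \<open>The same identity taken at \<open>m - 1\<close>, now used to step
      downwards.\<close>
    have cs: "\<i> * (exp (\<i> * of_real (2 * of_int (m-1) * u)) + exp (\<i> * of_real (2 * of_int m * u)))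
        = of_real (cot u) * (exp (\<i> * of_real (2 * of_int m * u)) - exp (\<i> * of_real (2 * of_int (m-1) * u)))"
      using cot_mult_exp_mode_diff[OF u, of "m - 1"] unfolding diff_add_cancel by (subst add.commute) (rule sym)
    have "((\<lambda>u. P u - \<i> * (E' u + E u)) has_vector_derivative of_real (cot u) * (exp (\<i> * of_real (2 * of_int m * u)) - 1) - \<i> * (exp (\<i> * of_real (2 * of_int (m-1) * u)) + exp (\<i> * of_real (2 * of_int m * u)))) (at u)"
      using P u by (intro has_vector_derivative_diff has_vector_derivative_add has_vector_derivative_mult_right E E') blast+
    then show "((\<lambda>u. P u - \<i> * (E' u + E u)) has_vector_derivative of_real (cot u) * (exp (\<i> * of_real (2 * of_int (m-1) * u)) - 1)) (at u)"
      unfolding cs by (simp add: right_diff_distrib)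
  qed
qed

section \<open>Asymptotics of the jump at the singularity\<close>

text \<open>For \<open>c = m\<close> the first two terms are, up to the factor \<open>\<i>\<close>,
  the jump of the boundary terms across 0. Each of them behaves like \<open>2 * c / x\<close>, which
  accounts for the constant 4.\<close>

lemma cot_mode_jump_tendsto_0:
  fixes c :: real
  shows "((\<lambda>x. sin (2 * c * x) / sin x ^ 2 + 2 * c * cot x * cos (2 * c * x) - 4 * c / x) \<longlongrightarrow> 0) (at_right 0)"
proof -
  \<comment> \<open>The sign of \<open>c\<close> is fixed before expanding; for \<open>c = 0\<close>
    both functions vanish.\<close>
  have A: "((\<lambda>x. (sin (2 * c * x) - 2 * c * x) / x ^ 2) \<longlongrightarrow> 0) (at_right 0)"
    and D: "((\<lambda>x. 2 * c * (cos (2 * c * x) - 1) / x) \<longlongrightarrow> 0) (at_right 0)"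
    by (cases c "0::real" rule: linorder_cases; simp?; real_asymp)+
  have B: "((\<lambda>x::real. (x / sin x) ^ 2) \<longlongrightarrow> 1) (at_right 0)" by real_asymp
  have C: "((\<lambda>x::real. x / sin x ^ 2 - 1 / x) \<longlongrightarrow> 0) (at_right 0)" by real_asymp
  have C2: "((\<lambda>x::real. cos x / sin x - 1 / x) \<longlongrightarrow> 0) (at_right 0)" by real_asymp
  have cc: "((\<lambda>x. cos (2 * c * x)) \<longlongrightarrow> cos (2 * c * 0)) (at_right 0)"
    by (intro tendsto_intros)
  \<comment> \<open>The expression is regrouped into pieces that each tend to 0: the first two add
    up to \<open>sin (2 * c * x) / sin x ^ 2 - 2 * c / x\<close>, the last two to
    \<open>2 * c * cot x * cos (2 * c * x) - 2 * c / x\<close>.\<close>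
  have lim: "((\<lambda>x. (sin (2 * c * x) - 2 * c * x) / x ^ 2 * (x / sin x) ^ 2 + 2 * c * (x / sin x ^ 2 - 1 / x)
     + 2 * c * (cos x / sin x - 1 / x) * cos (2 * c * x) + 2 * c * (cos (2 * c * x) - 1) / x) 
     \<longlongrightarrow> 0 * 1 + 2 * c * 0 + 2 * c * 0 * cos (2 * c * 0) + 0) (at_right 0)"
    by (intro tendsto_add tendsto_mult A B C C2 D cc tendsto_const)
  have ev: "eventually (\<lambda>x. (sin (2 * c * x) - 2 * c * x) / x ^ 2 * (x / sin x) ^ 2 + 2 * c * (x / sin x ^ 2 - 1 / x)
     + 2 * c * (cos x / sin x - 1 / x) * cos (2 * c * x) + 2 * c * (cos (2 * c * x) - 1) / x
     = sin (2 * c * x) / sin x ^ 2 + 2 * c * cot x * cos (2 * c * x) - 4 * c / x) (at_right 0)"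
  proof -
    have "eventually (\<lambda>x::real. x \<in> {0<..<pi}) (at_right 0)"
      by (rule eventually_at_right_real) simp
    then show ?thesis
    proof eventually_elim
      case (elim x)
      then have "x \<noteq> 0" by simp
      then have "(sin (2 * c * x) - 2 * c * x) / x ^ 2 * (x / sin x) ^ 2 = (sin (2 * c * x) - 2 * c * x) / sin x ^ 2"
        by (simp add: power_divide)
      also have "\<dots> = sin (2 * c * x) / sin x ^ 2 - 2 * c * (x / sin x ^ 2)"
        by (simp add: diff_divide_distrib)
      finally have 1: "(sin (2 * c * x) - 2 * c * x) / x ^ 2 * (x / sin x) ^ 2 = sin (2 * c * x) / sin x ^ 2 - 2 * c * (x / sin x ^ 2)" .
      have 2: "2 * c * (cos (2 * c * x) - 1) / x = 2 * c * cos (2 * c * x) * (1 / x) - 2 * c * (1 / x)"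
        by (simp add: right_diff_distrib diff_divide_distrib)
      have 3: "4 * c / x = 4 * c * (1 / x)"
        by simp
      have "(A - 2*c*q) + 2*c*(q-r) + 2*c*(k-r)*C + (2*c*C*r-2*c*r) = A + 2*c*k*C - 4*c*r" for A q r k C :: real
        by (simp add: algebra_simps)
      then show ?case unfolding 1 2 3 cot_def .
    qed
  qed
  have z: "0 * 1 + 2 * c * 0 + 2 * c * 0 * cos (2 * c * 0) + 0 = 0"
    by simp
  show ?thesis
    by (rule Lim_transform_eventually[OF lim[unfolded z] ev])
qed

section \<open>Antiderivative of the kernel times a mode\<close>

text \<open>Both integrations by parts in differentiated form: \<open>cos u / sin u ^ 3\<close> is
  integrated to \<open>- 1 / (2 * sin u ^ 2)\<close>, then \<open>1 / sin u ^ 2\<close> to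
  \<open>- cot u\<close>. The terms with \<open>1 / sin u ^ 2\<close> cancel.\<close>

lemma has_vector_derivative_mode_boundary_terms:
  fixes u :: real
  assumes u: "sin u \<noteq> 0"
  shows "((\<lambda>u. - exp (\<i> * of_real (2 * of_int m * u)) / of_real (2 * sin u ^ 2)
        - \<i> * of_int m * of_real (cot u) * exp (\<i> * of_real (2 * of_int m * u)))
     has_vector_derivative
       of_real (cos u / sin u ^ 3) * exp (\<i> * of_real (2 * of_int m * u))
        + 2 * of_int (m ^ 2) * of_real (cot u) * exp (\<i> * of_real (2 * of_int m * u))) (at u)"
proof -
  define w where "w = (\<lambda>u::real. exp (\<i> * of_real (2 * of_int m * u)))"
  have w: "(w has_vector_derivative 2 * \<i> * of_int m * w u) (at u)"
  proof -
    have "((\<lambda>z. exp (\<i> * (2 * of_int m * z))) has_field_derivative 2 * \<i> * of_int m * exp (\<i> * (2 * of_int m * z))) (at z)" for z :: complex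
      by (auto intro!: derivative_eq_intros)
    from has_vector_derivative_real_field[OF this[of "of_real u"]] show ?thesis
      by (simp add: w_def)
  qed
  have c: "((\<lambda>u. of_real (cot u) :: complex) has_vector_derivative of_real (- inverse (sin u ^ 2))) (at u)"
    using DERIV_cot[OF u] has_vector_derivative_of_real by blast
  have s: "((\<lambda>u. of_real (- 1 / (2 * sin u ^ 2)) :: complex) has_vector_derivative of_real (cos u / sin u ^ 3)) (at u)"
    by (rule has_vector_derivative_of_real)
       (use u in \<open>auto intro!: derivative_eq_intros simp: power2_eq_square power3_eq_cube field_simps\<close>)
  have "((\<lambda>u. of_real (- 1 / (2 * sin u ^ 2)) * w u - \<i> * of_int m * (of_real (cot u) * w u)) has_vector_derivative
     (of_real (- 1 / (2 * sin u ^ 2)) * (2 * \<i> * of_int m * w u) + of_real (cos u / sin u ^ 3) * w u)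
     - \<i> * of_int m * (of_real (cot u) * (2 * \<i> * of_int m * w u) + of_real (- inverse (sin u ^ 2)) * w u)) (at u)"
    by (intro has_vector_derivative_diff has_vector_derivative_mult has_vector_derivative_mult_right w s c)
  moreover have "(of_real (- 1 / (2 * sin u ^ 2)) * (2 * \<i> * of_int m * w u) + of_real (cos u / sin u ^ 3) * w u)
     - \<i> * of_int m * (of_real (cot u) * (2 * \<i> * of_int m * w u) + of_real (- inverse (sin u ^ 2)) * w u)
     = of_real (cos u / sin u ^ 3) * w u + 2 * of_int (m ^ 2) * of_real (cot u) * w u"
    by (simp add: field_simps power2_eq_square)
  ultimately show ?thesis
    by (simp add: w_def algebra_simps)
qed

text \<open>\<open>\<Phi>\<close> consists of the boundary terms minus \<open>2 * m ^ 2\<close>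
  times an antiderivative of the cotangent mode, split into a logarithm and a continuous part. Only
  the continuous part changes over a period, and its own jump across 0 vanishes in the
  limit.\<close>

lemma kernel_mode_antiderivative:
  "\<exists>(\<Phi> :: real \<Rightarrow> complex) P.
     (\<forall>u. sin u \<noteq> 0 \<longrightarrow> (\<Phi> has_vector_derivative of_real (cos u / sin u ^ 3) * exp (\<i> * of_real (2 * of_int m * u))) (at u))
   \<and> (\<forall>u. \<Phi> (u + pi) - \<Phi> u = - 2 * of_int (m ^ 2) * \<i> * of_real pi * of_int (sgn m))
   \<and> isCont P 0
   \<and> (\<forall>u. \<Phi> (- u) - \<Phi> u = \<i> * of_real (sin (2 * of_int m * u) / sin u ^ 2 + 2 * of_int m * cot u * cos (2 * of_int m * u)) + P u - P (- u))"
proof -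
  obtain P :: "real \<Rightarrow> complex" where P: "\<And>u. isCont P u"
    "\<And>u. sin u \<noteq> 0 \<Longrightarrow> (P has_vector_derivative of_real (cot u) * (exp (\<i> * of_real (2 * of_int m * u)) - 1)) (at u)"
    "\<And>u. P (u + pi) - P u = \<i> * of_real pi * of_int (sgn m)"
    using cot_mode_antiderivative[of m] by blast
  define A where "A = (\<lambda>u::real. - exp (\<i> * of_real (2 * of_int m * u)) / of_real (2 * sin u ^ 2)
        - \<i> * of_int m * of_real (cot u) * exp (\<i> * of_real (2 * of_int m * u)))"
  \<comment> \<open>This is the logarithm of \<open>\<bar>sin u\<bar>\<close>. The square makes it
    even and periodic, so it drops out of both the jump and the period increment.\<close>
  define l where "l = (\<lambda>u::real. ln (sin u ^ 2) / 2)"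
  define c :: complex where "c = 2 * of_int (m ^ 2)"
  define \<Phi> where "\<Phi> = (\<lambda>u. A u - c * (of_real (l u) + P u))"
  have "(\<Phi> has_vector_derivative of_real (cos u / sin u ^ 3) * exp (\<i> * of_real (2 * of_int m * u))) (at u)" if u: "sin u \<noteq> 0" for u
  proof -
    have "(l has_field_derivative cot u) (at u)"
      unfolding l_def using u zero_less_power2[of "sin u"]
      by (auto intro!: derivative_eq_intros simp: cot_def field_simps) (simp_all add: power2_eq_square)
    then have l: "((\<lambda>u. of_real (l u) :: complex) has_vector_derivative of_real (cot u)) (at u)"
      by (rule has_vector_derivative_of_real)
    have "(\<Phi> has_vector_derivative
        (of_real (cos u / sin u ^ 3) * exp (\<i> * of_real (2 * of_int m * u))
        + 2 * of_int (m ^ 2) * of_real (cot u) * exp (\<i> * of_real (2 * of_int m * u)))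
        - c * (of_real (cot u) + of_real (cot u) * (exp (\<i> * of_real (2 * of_int m * u)) - 1))) (at u)"
      unfolding \<Phi>_def A_def
      by (intro has_vector_derivative_diff has_vector_derivative_mult_right has_vector_derivative_add l P u has_vector_derivative_mode_boundary_terms)
    then show ?thesis by (simp add: c_def algebra_simps)
  qed
  moreover have "\<Phi> (u + pi) - \<Phi> u = - 2 * of_int (m ^ 2) * \<i> * of_real pi * of_int (sgn m)" for u
  proof -
    have "\<i> * of_real (2 * of_int m * (u + pi)) = \<i> * of_real (2 * of_int m * u) + \<i> * (of_int m * (of_real pi * 2))"
      by (simp add: algebra_simps)
    then have "A (u + pi) = A u"
      by (simp only: A_def exp_plus_2pin) (simp add: cot_def)
    moreover have "l (u + pi) = l u" by (simp add: l_def)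
    ultimately have "\<Phi> (u + pi) - \<Phi> u = - c * (P (u + pi) - P u)"
      by (simp add: \<Phi>_def algebra_simps)
    then show ?thesis unfolding P(3) by (simp add: c_def)
  qed
  moreover have "\<Phi> (- u) - \<Phi> u = \<i> * of_real (sin (2 * of_int m * u) / sin u ^ 2 + 2 * of_int m * cot u * cos (2 * of_int m * u)) + c * P u - c * P (- u)" for u
  proof -
    \<comment> \<open>Only the odd part of \<open>A\<close> survives: the sine against the even
      \<open>1 / sin u ^ 2\<close> and the cosine against the odd cotangent. At zeros of the sine
      both sides are 0 by the convention for division.\<close>
    have "A (- u) - A u = \<i> * of_real (sin (2 * of_int m * u) / sin u ^ 2 + 2 * of_int m * cot u * cos (2 * of_int m * u))"
      unfolding A_def cis_conv_exp[symmetric]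
      by (simp add: complex_eq_iff cot_def field_simps)
    moreover have "l (- u) = l u" by (simp add: l_def)
    ultimately show ?thesis by (simp add: \<Phi>_def algebra_simps)
  qed
  moreover have "isCont (\<lambda>u. c * P u) 0"
    using P(1) by (intro continuous_intros)
  ultimately show ?thesis
    by (intro exI[of _ \<Phi>] exI[of _ "\<lambda>u. c * P u"]) blast
qed

section \<open>The numerator and the finite part\<close>

lemma abs_scaled_less_pi: "\<bar>d\<bar> < T \<Longrightarrow> \<bar>pi * d / T\<bar> < pi"
  by (simp add: abs_mult pos_divide_less_eq)

text \<open>The numerator extends holomorphically to a neighbourhood of the interval. At
  \<open>t\<close> the cosine and the sinc factor are stationary, so only the exponential
  contributes to the derivative; with \<open>k = pi / T\<close>, the factor
  \<open>(T / pi) ^ 2\<close> is \<open>k / k ^ 3\<close>.\<close>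

lemma f_ss_smooth_numerator:
  assumes T: "T = b - a" and t: "a < t" "t < b"
  shows "\<exists>g. C_infinity_on g a b \<and> (\<forall>x\<in>{a..b} - {t}. f_ss T t m x = g x / of_real ((x - t) ^ 3)) \<and>
    vector_derivative g (at t) = of_real ((T / pi) ^ 2) * e_mode T m t * (2 * \<i> * of_int m)"
proof -
  define k where "k = pi / T"
  have k: "k > 0" using T t by (simp add: k_def)
  define s where "s = (\<lambda>z::complex. csinc (of_real k * (z - of_real t)))"
  define G where "G = (\<lambda>z. cos (of_real k * (z - of_real t)) / (of_real k * s z) ^ 3 * exp (2 * \<i> * of_int m * of_real k * z))"
  define g where "g = (\<lambda>x::real. G (of_real x))"
  \<comment> \<open>The zeros of \<open>s\<close> are \<open>t\<close> plus nonzero multiples of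
    \<open>T\<close>, all outside \<open>{a..b}\<close>.\<close>
  define S where "S = {z. s z \<noteq> 0}"
  have s_hol: "s holomorphic_on UNIV"
  proof -
    have "(csinc \<circ> (\<lambda>z. of_real k * (z - of_real t))) holomorphic_on UNIV"
      by (rule holomorphic_on_compose_gen[OF _ holomorphic_csinc]) (auto intro!: holomorphic_intros)
    then show ?thesis by (simp add: s_def o_def)
  qed
  have e: "exp (2 * \<i> * of_int m * of_real k * of_real x) = e_mode T m x" for x
    by (simp add: e_mode_def k_def mult_ac)
  have ne: "s (of_real x) \<noteq> 0" if "x \<in> {a..b}" for x
  proof -
    have "\<bar>x - t\<bar> < T" using that T t by auto
    then have "\<bar>k * (x - t)\<bar> < pi"
      using abs_scaled_less_pi by (simp add: k_def)
    then show ?thesis using csinc_of_real_nonzero by (fastforce simp: s_def)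
  qed
  have "open S"
    unfolding S_def using holomorphic_on_imp_continuous_on[OF s_hol]
    by (intro open_Collect_neq continuous_intros) auto
  moreover have "G holomorphic_on S"
    unfolding G_def using k
    by (intro holomorphic_intros holomorphic_on_subset[OF s_hol]) (auto simp: S_def)
  ultimately have C: "C_infinity_on g a b"
    unfolding g_def by (rule C_infinity_on_holomorphic) (simp add: S_def ne)
  have f: "f_ss T t m x = g x / of_real ((x - t) ^ 3)" if "x \<in> {a..b} - {t}" for x
  proof -
    have "s (of_real x) = of_real (sin (k * (x - t)) / (k * (x - t)))"
      using that k by (simp add: s_def csinc_def sin_of_real[symmetric])
    then have "g x = of_real (cos (k * (x - t)) / (sin (k * (x - t)) / (x - t)) ^ 3) * e_mode T m x"
      using k by (simp add: g_def G_def e cos_of_real[symmetric])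
    then show ?thesis using that
      by (simp add: f_ss_def K_ss_def k_def power_divide field_simps)
  qed
  have "((\<lambda>z. of_real k * (z - of_real t)) has_field_derivative of_real k) (at (of_real t))"
    by (auto intro!: derivative_eq_intros)
  then have "(s has_field_derivative 0) (at (of_real t))"
    unfolding s_def using DERIV_chain2[of csinc 0 "\<lambda>z. of_real k * (z - of_real t)" "of_real t"] DERIV_csinc_0 by simp
  then have "(G has_field_derivative 2 * \<i> * of_int m * of_real k * exp (2 * \<i> * of_int m * of_real k * of_real t) / of_real k ^ 3) (at (of_real t))"
    unfolding G_def using k
    by (auto intro!: derivative_eq_intros simp: s_def csinc_def) (simp add: eval_nat_numeral)
  then have "(g has_vector_derivative 2 * \<i> * of_int m * of_real k * e_mode T m t / of_real k ^ 3) (at t)"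
    unfolding g_def e[symmetric] by (rule has_vector_derivative_real_field)
  then have "vector_derivative g (at t) = 2 * \<i> * of_int m * of_real k * e_mode T m t / of_real k ^ 3"
    by (rule vector_derivative_at)
  also have "\<dots> = of_real ((T / pi) ^ 2) * e_mode T m t * (2 * \<i> * of_int m)"
    using k by (simp add: k_def power2_eq_square power3_eq_cube field_simps)
  finally show ?thesis using C f by blast
qed

text \<open>After scaling, the outer endpoints enter only through one period increment of
  \<open>\<Phi>\<close>, which yields the value, and the inner ones only through the jump of
  \<open>\<Phi>\<close> across 0, which the correction term regularises.\<close>

lemma has_finite_part3_f_ss:
  assumes T: "T = b - a" and t: "a < t" "t < b"
  shows "has_finite_part3 (f_ss T t m) a b t
           (- \<i> * of_int (sgn m) * 2 * of_real T * of_int (m ^ 2) * e_mode T m t)"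
proof -
  obtain g where g: "C_infinity_on g a b" "\<And>x. x\<in>{a..b} - {t} \<Longrightarrow> f_ss T t m x = g x / of_real ((x - t) ^ 3)"
    "vector_derivative g (at t) = of_real ((T / pi) ^ 2) * e_mode T m t * (2 * \<i> * of_int m)"
    using f_ss_smooth_numerator[OF assms] by blast
  obtain \<Phi> P where \<Phi>: "\<And>u. sin u \<noteq> 0 \<Longrightarrow> (\<Phi> has_vector_derivative of_real (cos u / sin u ^ 3) * exp (\<i> * of_real (2 * of_int m * u))) (at u)"
    and per: "\<And>u. \<Phi> (u + pi) - \<Phi> u = - 2 * of_int (m ^ 2) * \<i> * of_real pi * of_int (sgn m)"
    and P: "isCont P 0"
    and jump: "\<And>u. \<Phi> (- u) - \<Phi> u = \<i> * of_real (sin (2 * of_int m * u) / sin u ^ 2 + 2 * of_int m * cot u * cos (2 * of_int m * u)) + P u - P (- u)"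
    using kernel_mode_antiderivative[of m] by blast
  have T0: "T > 0" using T t by simp
  \<comment> \<open>\<open>T / pi\<close> comes from the substitution
    \<open>u = pi * (x - t) / T\<close>, the second factor from splitting the mode at
    \<open>t\<close>.\<close>
  define C where "C = of_real (T / pi) * e_mode T m t"
  define \<Psi> where "\<Psi> = (\<lambda>x. C * \<Phi> (pi * (x - t) / T))"
  \<comment> \<open>An interval avoiding \<open>t\<close> is mapped to points with
    \<open>0 < \<bar>u\<bar> < pi\<close>, where the sine has no zero.\<close>
  have int: "integral {p..q} (\<lambda>x. g x / of_real ((x - t) ^ 3)) = \<Psi> q - \<Psi> p"
    if pq: "p \<le> q" "a \<le> p" "q \<le> b" "t \<notin> {p..q}" for p q
  proof (rule integral_unique, rule fundamental_theorem_of_calculus[OF pq(1)])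
    fix x assume x: "x \<in> {p..q}"
    define u where "u = pi * (x - t) / T"
    have "x \<noteq> t" "\<bar>x - t\<bar> < T" using x pq T t by auto
    then have "u \<noteq> 0" "\<bar>u\<bar> < pi" using T0 abs_scaled_less_pi by (simp_all add: u_def)
    then have "sin u \<noteq> 0" using sin_zero_pi_iff by blast
    moreover have "((\<lambda>x. pi * (x - t) / T) has_vector_derivative pi / T) (at x)"
      unfolding has_real_derivative_iff_has_vector_derivative[symmetric]
      using T0 by (auto intro!: derivative_eq_intros)
    ultimately have "(\<Phi> \<circ> (\<lambda>x. pi * (x - t) / T) has_vector_derivative (pi / T) *\<^sub>R (of_real (cos u / sin u ^ 3) * exp (\<i> * of_real (2 * of_int m * u)))) (at x)"
      using \<Phi>[of u] by (intro vector_diff_chain_at) (simp_all add: u_def)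
    then have "(\<Psi> has_vector_derivative C * ((pi / T) *\<^sub>R (of_real (cos u / sin u ^ 3) * exp (\<i> * of_real (2 * of_int m * u))))) (at x)"
      unfolding \<Psi>_def o_def by (rule has_vector_derivative_mult_right)
    also have "C * ((pi / T) *\<^sub>R (of_real (cos u / sin u ^ 3) * exp (\<i> * of_real (2 * of_int m * u)))) = f_ss T t m x"
    proof -
      have "e_mode T m x = e_mode T m t * exp (\<i> * of_real (2 * of_int m * u))"
        unfolding e_mode_def u_def exp_add[symmetric] using T0
        by (intro arg_cong[of _ _ exp]) (simp add: field_simps)
      then show ?thesis
        using T0 by (simp add: C_def f_ss_def K_ss_def u_def scaleR_conv_of_real)
    qed
    also have "\<dots> = g x / of_real ((x - t) ^ 3)"
      using g(2)[of x] x pq by force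
    finally show "(\<Psi> has_vector_derivative g x / of_real ((x - t) ^ 3)) (at x within {p..q})"
      by (rule has_vector_derivative_at_within)
  qed
  define L where "L = C * (- 2 * of_int (m ^ 2) * \<i> * of_real pi * of_int (sgn m))"
  define R where "R = (\<lambda>\<delta>::real. sin (2 * of_int m * \<delta>) / sin \<delta> ^ 2 + 2 * of_int m * cot \<delta> * cos (2 * of_int m * \<delta>) - 4 * of_int m / \<delta>)"
  \<comment> \<open>The regularised sum of integrals, as a function of the scaled radius
    \<open>\<delta> = pi * \<epsilon> / T\<close>.\<close>
  define H where "H = (\<lambda>\<delta>::real. C * (\<i> * of_real (R \<delta>) + (P \<delta> - P (- \<delta>))) + L)"
  have "(P \<longlongrightarrow> P 0) (at 0)" using P by (simp add: isCont_def)
  then have P1: "(P \<longlongrightarrow> P 0) (at_right 0)" and P2: "(P \<longlongrightarrow> P 0) (at_left 0)"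
    by (auto intro: tendsto_within_subset)
  have "((\<lambda>\<delta>. P (- \<delta>)) \<longlongrightarrow> P 0) (at_right 0)"
    using P2 by (simp add: filterlim_at_left_to_right)
  then have "(H \<longlongrightarrow> C * (\<i> * of_real 0 + (P 0 - P 0)) + L) (at_right 0)"
    unfolding H_def R_def by (intro tendsto_intros cot_mode_jump_tendsto_0 P1)
  moreover have "filterlim (\<lambda>\<epsilon>. pi * \<epsilon> / T) (at_right 0) (at_right 0)"
    using T0 by real_asymp
  ultimately have "((\<lambda>\<epsilon>. H (pi * \<epsilon> / T)) \<longlongrightarrow> L) (at_right 0)"
    using filterlim_compose by fastforce
  moreover have "eventually (\<lambda>\<epsilon>. \<epsilon> \<in> {0<..<min (t - a) (b - t)}) (at_right 0)"
    using t by (intro eventually_at_right_real) simp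
  then have "eventually (\<lambda>\<epsilon>. H (pi * \<epsilon> / T) = integral {a..t - \<epsilon>} (\<lambda>x. g x / of_real ((x - t) ^ 3))
             + integral {t + \<epsilon>..b} (\<lambda>x. g x / of_real ((x - t) ^ 3))
             - 2 * vector_derivative g (at t) / of_real \<epsilon>) (at_right 0)"
  proof eventually_elim
    case (elim \<epsilon>)
    define \<delta> where "\<delta> = pi * \<epsilon> / T"
    \<comment> \<open>Since \<open>b - a = T\<close>, the images of the endpoints are exactly one
      period apart.\<close>
    have "pi * (b - t) / T = pi * (a - t) / T + pi" "pi * (t - \<epsilon> - t) / T = - \<delta>" "pi * (t + \<epsilon> - t) / T = \<delta>"
      using T0 by (simp_all add: \<delta>_def T field_simps)
    then have "(\<Psi> (t - \<epsilon>) - \<Psi> a) + (\<Psi> b - \<Psi> (t + \<epsilon>)) = C * (\<Phi> (- \<delta>) - \<Phi> \<delta>) + C * (\<Phi> (pi * (a - t) / T + pi) - \<Phi> (pi * (a - t) / T))"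
      by (simp add: \<Psi>_def algebra_simps)
    also have "\<dots> = C * (\<Phi> (- \<delta>) - \<Phi> \<delta>) + L"
      by (simp only: per L_def)
    also have "\<Phi> (- \<delta>) - \<Phi> \<delta> = \<i> * of_real (R \<delta>) + (P \<delta> - P (- \<delta>)) + 4 * \<i> * of_int m / of_real \<delta>"
      unfolding jump R_def by (simp add: algebra_simps)
    also have "C * \<dots> + L = H \<delta> + C * (4 * \<i> * of_int m / of_real \<delta>)"
      by (simp add: H_def algebra_simps)
    \<comment> \<open>The divergent part of the jump matches the prescribed correction exactly:
      \<open>1 / \<delta>\<close> supplies the second factor \<open>T / pi\<close>.\<close>
    also have "C * (4 * \<i> * of_int m / of_real \<delta>) = 2 * vector_derivative g (at t) / of_real \<epsilon>"
      unfolding g(3) C_def \<delta>_def using elim T0 by (simp add: field_simps power2_eq_square)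
    finally have sum: "(\<Psi> (t - \<epsilon>) - \<Psi> a) + (\<Psi> b - \<Psi> (t + \<epsilon>)) = H \<delta> + 2 * vector_derivative g (at t) / of_real \<epsilon>" .
    have ints: "integral {a..t - \<epsilon>} (\<lambda>x. g x / of_real ((x - t) ^ 3)) = \<Psi> (t - \<epsilon>) - \<Psi> a"
      "integral {t + \<epsilon>..b} (\<lambda>x. g x / of_real ((x - t) ^ 3)) = \<Psi> b - \<Psi> (t + \<epsilon>)"
      by (rule int; use elim t in simp)+
    show ?case unfolding ints sum by (simp add: \<delta>_def)
  qed
  ultimately have "((\<lambda>\<epsilon>. integral {a..t - \<epsilon>} (\<lambda>x. g x / of_real ((x - t) ^ 3))
             + integral {t + \<epsilon>..b} (\<lambda>x. g x / of_real ((x - t) ^ 3))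
             - 2 * vector_derivative g (at t) / of_real \<epsilon>) \<longlongrightarrow> L) (at_right 0)"
    by (rule Lim_transform_eventually)
  moreover have "L = - \<i> * of_int (sgn m) * 2 * of_real T * of_int (m ^ 2) * e_mode T m t"
    by (simp add: L_def C_def)
  ultimately show ?thesis
    unfolding has_finite_part3_def using g t by blast
qed

theorem theorem2p2:
  fixes a b T t :: real and m :: int
  assumes "a < b" and "T = b - a" and "t \<in> {a<..<b}"
  shows "has_finite_part3 (f_ss T t m) a b t
           (- \<i> * of_int (sgn m) * 2 * of_real T * of_int (m ^ 2) * e_mode T m t)
       \<and> finite_part3 (f_ss T t m) a b t
           = - \<i> * of_int (sgn m) * 2 * of_real T * of_int (m ^ 2) * e_mode T m t"
proof -
  have "has_finite_part3 (f_ss T t m) a b t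
           (- \<i> * of_int (sgn m) * 2 * of_real T * of_int (m ^ 2) * e_mode T m t)"
    using assms by (intro has_finite_part3_f_ss) auto
  then show ?thesis
    unfolding finite_part3_def by (blast intro: the_equality has_finite_part3_unique)
qed

end
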